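(* Let $G=(V,E)$ be a finite connected undirected graph representing a network of agents, let $\lambda>0$, and for each $v\in V$ let $f_v:\mathbb{R}\to\mathbb{R}$ be a convex function, such that the infimum $\inf_{x\in\mathbb{R}}\sum_{v\in V}f_v(x)$ is attained at some point of $\mathbb{R}$. Assume that there is a constant $C>0$ such that $|g|\le C(1+|x|)$ for all $v\in V$, all $x\in\mathbb{R}$ and all $g\in\partial f_v(x)$. Let the step sizes $(\gamma_n)_{n\ge 0}$ satisfy $\gamma_n>0$ for all $n$, $\sum_n\gamma_n=+\infty$ and $\sum_n\gamma_n^2<\infty$. Assume that all agents are regular, i.e. that every $v\in V$ follows, for all $n\ge0$, the update rule $$x_{n+1}(v)=x_n(v)+\gamma_n\Big[g_n(v)+\lambda\sum_{w\sim v}\mathrm{sign}\big(x_n(w)-x_n(v)\big)\Big],\qquad g_n(v)\in-\partial f_v(x_n(v)).$$ Then the sequence $x_n$ converges to the set of minimizers of the problem $$\min_{x\in\mathbb{R}^V}\ \sum_{v\in V}f_v(x(v))+\lambda\|x\|_{\mathrm{TV}}.$$ Moreover, in the average consensus case, where $f_v(x)=\frac12(x-x_0(v))^2$ for every $v\in V$ with $x_0\in\mathbb{R}^V$ the initial point of the sequence (so that $g_n(v)=x_0(v)-x_n(v)$), one has $\bar x_n=\bar x_0$ for all $n\ge0$.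
   Context: $\mathbb{R}^V$ is the space of functions $V\to\mathbb{R}$. For $x\in\mathbb{R}^V$, $\|x\|_{\mathrm{TV}}=\sum_{\{v,w\}\in E}|x(v)-x(w)|$ and $\bar x=\frac1{|V|}\sum_{v\in V}x(v)$. The notation $w\sim v$ means $\{v,w\}\in E$. $\partial f_v$ is the convex subdifferential, and $\mathrm{sign}(t)$ is $1$, $0$, $-1$ according to whether $t>0$, $t=0$, $t<0$.
   Formalization: Convergence is stated assuming the regularized problem has a minimizer; this does not follow from the hypotheses (one edge, f_1(t)=at, f_2(t)=-at, a>λ: the objective is unbounded below and there is no set of minimizers to converge to). *)

theory Defs
  imports "HOL-Analysis.Analysis"
begin

text \<open>
  A simple undirected graph has as vertices all elements of a finite type, and its edges are
  two-element sets of vertices. Vectors indexed by the vertices live in \<open>real ^ 'v\<close>.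
\<close>

definition connected_graph :: "'v set set \<Rightarrow> bool" where
  "connected_graph E \<longleftrightarrow>
     (\<forall>e\<in>E. card e = 2) \<and> (\<forall>v w. (v, w) \<in> {(a, b). {a, b} \<in> E}\<^sup>*)"

text \<open>The description is unambiguous for every edge; see \<open>edge_variation_pair\<close>.\<close>

definition edge_variation :: "real ^ 'v \<Rightarrow> 'v set \<Rightarrow> real" where
  "edge_variation x e = (THE d. \<exists>v w. e = {v, w} \<and> d = \<bar>x $ v - x $ w\<bar>)"

definition tv_norm :: "'v set set \<Rightarrow> real ^ 'v \<Rightarrow> real" where
  "tv_norm E x = (\<Sum>e\<in>E. edge_variation x e)"

lemma edge_variation_pair: "edge_variation x {v, w} = \<bar>x $ v - x $ w\<bar>"
  unfolding edge_variation_def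
  by (rule the_equality) (auto simp: doubleton_eq_iff abs_minus_commute)

definition average :: "real ^ 'v::finite \<Rightarrow> real" where
  "average x = (\<Sum>v\<in>UNIV. x $ v) / real CARD('v)"

definition subdifferential :: "(real \<Rightarrow> real) \<Rightarrow> real \<Rightarrow> real set" where
  "subdifferential f t = {g. \<forall>s. f s \<ge> f t + g * (s - t)}"

definition tv_objective ::
  "'v set set \<Rightarrow> real \<Rightarrow> ('v \<Rightarrow> real \<Rightarrow> real) \<Rightarrow> real ^ 'v::finite \<Rightarrow> real" where
  "tv_objective E lam f x = (\<Sum>v\<in>UNIV. f v (x $ v)) + lam * tv_norm E x"

text \<open>
  This set may be empty for \<open>tv_objective\<close> even if it is nonempty for the sum of the \<open>f v\<close> on the
  real line: take a single edge and the two linear functions \<open>a * t\<close> and \<open>- a * t\<close> with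
  \<open>a > lam\<close>. Moreover \<open>infdist\<close> to the empty set is \<open>0\<close>.
  Convergence to the set of minimizers is therefore stated under the explicit condition that it
  is nonempty.
\<close>

definition minimizers :: "('a \<Rightarrow> real) \<Rightarrow> 'a set" where
  "minimizers F = {x. is_arg_min F (\<lambda>_. True) x}"

end

theory Submission
  imports Defs
begin

text \<open>
  The update is a subgradient step for the convex function \<open>tv_objective E lam f\<close>: expanding the
  square gives, for every minimizer \<open>y\<close>, a Robbins--Siegmund inequality for
  \<open>(norm (x n - y))\<^sup>2\<close>. Hence these distances converge, and since the step sizes are not summable
  the objective comes arbitrarily close to its minimum along the iterates. Some cluster point \<open>z\<close> is
  thus a minimizer, and convergence of \<open>norm (x n - z)\<close> forces the whole sequence to tend to \<open>z\<close>.
  Averages are preserved because the sign term is antisymmetric in the two endpoints of an edge.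
\<close>

section \<open>Sums over adjacent pairs and the convex ingredients of the objective\<close>

text \<open>Adjacency is symmetric, so both sides run over the same ordered pairs. This replaces
  choosing an orientation of the edges.\<close>

lemma sum_neighbours_swap:
  fixes E :: "'v::finite set set" and h :: "'v \<Rightarrow> 'v \<Rightarrow> real"
  shows "(\<Sum>v\<in>UNIV. \<Sum>w | {v, w} \<in> E. h v w) = (\<Sum>v\<in>UNIV. \<Sum>w | {v, w} \<in> E. h w v)"
  using sum.swap_restrict[of UNIV UNIV h "\<lambda>v w. {v, w} \<in> E"]
  by (simp add: insert_commute)

lemma sum_neighbours_sgn:
  fixes E :: "'v::finite set set" and x :: "real ^ 'v"
  shows "(\<Sum>v\<in>UNIV. \<Sum>w | {v, w} \<in> E. sgn (x $ w - x $ v)) = 0"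
proof -
  have "(\<Sum>v\<in>UNIV. \<Sum>w | {v, w} \<in> E. sgn (x $ v - x $ w)) =
      (\<Sum>v\<in>UNIV. \<Sum>w | {v, w} \<in> E. - sgn (x $ w - x $ v))"
    by (intro sum.cong refl) (metis minus_diff_eq sgn_minus)
  also have "\<dots> = - (\<Sum>v\<in>UNIV. \<Sum>w | {v, w} \<in> E. sgn (x $ w - x $ v))"
    by (simp only: sum_negf)
  finally show ?thesis
    using sum_neighbours_swap[where E = E and h = "\<lambda>v w. sgn (x $ w - x $ v)"]
    by linarith
qed

text \<open>Grouping the ordered adjacent pairs by their underlying edge gives fibres of exactly two
  pairs, as the endpoints of an edge are distinct; hence the factor 2.\<close>

lemma tv_norm_sum_neighbours:
  fixes E :: "'v::finite set set"
  assumes "\<forall>e\<in>E. card e = 2"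
  shows "(\<Sum>v\<in>UNIV. \<Sum>w | {v, w} \<in> E. \<bar>x $ v - x $ w\<bar>) = 2 * tv_norm E x"
proof -
  have fibre: "(\<Sum>p | p \<in> {(v, w). {v, w} \<in> E} \<and> (case p of (v, w) \<Rightarrow> {v, w}) = e.
      \<bar>x $ fst p - x $ snd p\<bar>) = 2 * edge_variation x e" if e: "e \<in> E" for e
  proof -
    obtain a b where ab: "e = {a, b}" "a \<noteq> b"
      using assms e by (meson card_2_iff)
    have "{p. p \<in> {(v, w). {v, w} \<in> E} \<and> (case p of (v, w) \<Rightarrow> {v, w}) = e} = {(a, b), (b, a)}"
      using e ab by (auto simp: doubleton_eq_iff insert_commute)
    then show ?thesis
      using ab by (simp add: edge_variation_pair abs_minus_commute)
  qed
  have "(\<Sum>v\<in>UNIV. \<Sum>w | {v, w} \<in> E. \<bar>x $ v - x $ w\<bar>) =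
      (\<Sum>p\<in>{(v, w). {v, w} \<in> E}. \<bar>x $ fst p - x $ snd p\<bar>)"
    by (subst sum.Sigma) (auto intro!: sum.cong)
  also have "\<dots> = (\<Sum>e\<in>E. \<Sum>p | p \<in> {(v, w). {v, w} \<in> E} \<and> (case p of (v, w) \<Rightarrow> {v, w}) = e.
      \<bar>x $ fst p - x $ snd p\<bar>)"
    by (rule sum.group[symmetric]) auto
  also have "\<dots> = 2 * tv_norm E x"
    using fibre by (simp add: tv_norm_def sum_distrib_left)
  finally show ?thesis .
qed

text \<open>The negated sign sums form a subgradient of \<open>tv_norm E\<close> at
  \<open>x\<close>: the subgradient inequality of the absolute value holds edge by edge, and summing
  over ordered pairs doubles every term on both sides.\<close>

lemma tv_norm_subgradient:
  fixes E :: "'v::finite set set"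
  assumes "\<forall>e\<in>E. card e = 2"
  shows "tv_norm E y \<ge> tv_norm E x -
    (\<Sum>v\<in>UNIV. (\<Sum>w | {v, w} \<in> E. sgn (x $ w - x $ v)) * (y $ v - x $ v))"
proof -
  define h where "h v w = sgn (x $ w - x $ v) * (y $ v - x $ v)" for v w
  \<comment> \<open>The left side equals
    \<open>sgn (x $ v - x $ w) * (y $ v - y $ w)\<close>.\<close>
  have "\<bar>x $ v - x $ w\<bar> - h v w - h w v \<le> \<bar>y $ v - y $ w\<bar>" for v w
    by (auto simp: h_def sgn_if)
  then have le: "(\<Sum>v\<in>UNIV. \<Sum>w | {v, w} \<in> E. \<bar>x $ v - x $ w\<bar> - h v w - h w v) \<le>
      (\<Sum>v\<in>UNIV. \<Sum>w | {v, w} \<in> E. \<bar>y $ v - y $ w\<bar>)"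
    by (intro sum_mono)
  have swap: "(\<Sum>v\<in>UNIV. \<Sum>w | {v, w} \<in> E. h w v) =
      (\<Sum>v\<in>UNIV. \<Sum>w | {v, w} \<in> E. h v w)"
    by (rule sum_neighbours_swap)
  have eq: "(\<Sum>v\<in>UNIV. \<Sum>w | {v, w} \<in> E. \<bar>x $ v - x $ w\<bar> - h v w - h w v) =
      2 * tv_norm E x - 2 * (\<Sum>v\<in>UNIV. \<Sum>w | {v, w} \<in> E. h v w)"
    unfolding sum_subtractf swap tv_norm_sum_neighbours[OF assms] by simp
  from le have "tv_norm E x - (\<Sum>v\<in>UNIV. \<Sum>w | {v, w} \<in> E. h v w) \<le> tv_norm E y"
    unfolding eq tv_norm_sum_neighbours[OF assms] by simp
  then show ?thesis
    by (simp add: h_def sum_distrib_right)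
qed

lemma continuous_on_tv_objective:
  fixes E :: "'v::finite set set"
  assumes "\<forall>e\<in>E. card e = 2" and "\<And>v. convex_on UNIV (f v)"
  shows "continuous_on UNIV (tv_objective E lam f)"
proof -
  have "continuous_on UNIV (\<lambda>x::real^'v. edge_variation x e)" if e: "e \<in> E" for e
  proof -
    obtain v w where "e = {v, w}"
      using assms e by (meson card_2_iff)
    then show ?thesis
      by (auto simp: edge_variation_pair intro!: continuous_intros)
  qed
  moreover have "continuous_on UNIV (\<lambda>x::real^'v. f v (x $ v))" for v
    by (rule continuous_on_compose2[OF convex_on_continuous[OF open_UNIV assms(2)]])
      (auto intro!: continuous_intros)
  ultimately show ?thesis
    unfolding tv_objective_def tv_norm_def by (intro continuous_intros) auto
qed

lemma subdifferential_quadratic: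
  assumes "h \<in> subdifferential (\<lambda>t. 1/2 * (t - a)\<^sup>2) t"
  shows "h = t - a"
proof -
  \<comment> \<open>The discrepancy \<open>e\<close> also serves as the displacement of the test
    point: at \<open>t + e\<close> the subgradient inequality reduces to
    \<open>e\<^sup>2 / 2 \<ge> e\<^sup>2\<close>.\<close>
  define e where "e = h - (t - a)"
  have "1/2 * (t + e - a)\<^sup>2 \<ge> 1/2 * (t - a)\<^sup>2 + h * e"
    using assms by (auto simp: subdifferential_def dest: spec[of _ "t + e"])
  then have "e\<^sup>2 \<le> 0"
    by (simp add: e_def power2_eq_square algebra_simps)
  then show ?thesis
    by (simp add: e_def)
qed

section \<open>Convergence of the abstract subgradient method\<close>

text \<open>Deterministic form of the Robbins--Siegmund lemma.\<close>

lemma robbins_siegmund: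
  fixes a b u :: "nat \<Rightarrow> real"
  assumes step: "\<And>n. a (Suc n) \<le> (1 + b n) * a n + b n - u n"
    and a: "\<And>n. a n \<ge> 0" and b: "\<And>n. b n \<ge> 0" and u: "\<And>n. u n \<ge> 0"
    and sb: "summable b"
  shows "convergent a" and "summable u"
proof -
  define P where "P n = (\<Prod>k<n. 1 + b k)" for n
  \<comment> \<open>Adding 1 absorbs the additive error, since
    \<open>(1 + b n) * a n + b n + 1 = (1 + b n) * (a n + 1)\<close>; dividing by \<open>P n\<close>
    then removes the growth factors, so \<open>B\<close> is nonincreasing.\<close>
  define B where "B n = (a n + 1) / P n" for n
  have PSuc: "P (Suc n) = P n * (1 + b n)" for n
    by (simp add: P_def)
  have P1: "P n \<ge> 1" for n
    unfolding P_def using b by (intro prod_ge_1) auto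
  then have Ppos: "P n > 0" for n
    using less_le_trans zero_less_one by blast
  have Pmono: "incseq P"
    using Ppos b by (intro incseq_SucI) (simp add: PSuc algebra_simps less_imp_le)
  have Pbound: "P n \<le> exp (suminf b)" for n
  proof -
    have "P n \<le> (\<Prod>k<n. exp (b k))"
      unfolding P_def using b by (intro prod_mono) (auto intro: add_nonneg_nonneg)
    also have "\<dots> = exp (\<Sum>k<n. b k)"
      by (simp add: exp_sum)
    also have "\<dots> \<le> exp (suminf b)"
      using sum_le_suminf[OF sb] b by auto
    finally show ?thesis .
  qed
  have Pconv: "convergent P"
    using incseq_convergent[OF Pmono, of "exp (suminf b)"] Pbound convergent_def by metis
  \<comment> \<open>The uniform bound on \<open>P\<close> gives \<open>u n\<close> a weight
    independent of \<open>n\<close>, so telescoping bounds the partial sums of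
    \<open>u\<close>.\<close>
  have Bstep: "B (Suc n) + u n / exp (suminf b) \<le> B n" for n
  proof -
    have "u n / exp (suminf b) \<le> u n / P (Suc n)"
      using u Ppos Pbound by (intro divide_left_mono) (auto intro: mult_pos_pos)
    moreover have "(a (Suc n) + 1 + u n) / P (Suc n) \<le> ((1 + b n) * (a n + 1)) / P (Suc n)"
      using step[of n] Ppos[of "Suc n"] by (intro divide_right_mono) (auto simp: algebra_simps)
    moreover have "((1 + b n) * (a n + 1)) / P (Suc n) = B n"
      using b[of n] by (simp add: B_def PSuc divide_simps)
    ultimately show ?thesis
      by (simp add: B_def add_divide_distrib)
  qed
  have B0: "B n \<ge> 0" for n
    using a[of n] Ppos[of n] by (simp add: B_def)
  have "B (Suc n) \<le> B n" for n
    using Bstep[of n] u[of n] by (smt (verit) divide_nonneg_pos exp_gt_zero)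
  then have "convergent B"
    using decseq_convergent[of B 0] B0 by (metis convergent_def decseq_SucI)
  then have "convergent (\<lambda>n. B n * P n - 1)"
    using Pconv by (intro convergent_diff convergent_mult convergent_const)
  moreover have "(\<lambda>n. B n * P n - 1) = a"
    using Ppos by (auto simp: B_def fun_eq_iff less_imp_neq[symmetric])
  ultimately show "convergent a"
    by simp
  have "(\<Sum>k<n. u k / exp (suminf b)) \<le> B 0 - B n" for n
    using Bstep by (induction n) (auto, smt (verit))
  then have "(\<Sum>k<n. u k / exp (suminf b)) \<le> B 0" for n
    using B0 by (smt (verit))
  then have "summable (\<lambda>k. u k / exp (suminf b))"
    using u by (intro summableI_nonneg_bounded[where x = "B 0"]) auto
  then have "summable (\<lambda>k. u k / exp (suminf b) * exp (suminf b))"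
    by (rule summable_mult2)
  then show "summable u"
    by simp
qed

text \<open>The subgradient inequality is assumed only at the iterates, with growth at most linear
  in the iterate. The conclusion is convergence to a single minimizer, which is stronger than
  convergence to the set of minimizers.\<close>

lemma subgradient_method_convergence:
  fixes F :: "'a::euclidean_space \<Rightarrow> real" and x d :: "nat \<Rightarrow> 'a"
  assumes cont: "continuous_on UNIV F"
    and ne: "minimizers F \<noteq> {}"
    and step_pos: "\<And>n. \<gamma> n > 0"
    and step_sum: "filterlim (\<lambda>n. \<Sum>k<n. \<gamma> k) at_top sequentially"
    and step_square: "summable (\<lambda>n. (\<gamma> n)\<^sup>2)"
    and sub: "\<And>n y. F y \<ge> F (x n) + d n \<bullet> (y - x n)"
    and bound: "\<And>n. norm (d n) \<le> M * (1 + norm (x n))"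
    and update: "\<And>n. x (Suc n) = x n - \<gamma> n *\<^sub>R d n"
  obtains z where "z \<in> minimizers F" "x \<longlonglongrightarrow> z"
proof -
  have M: "M \<ge> 0"
    using bound[of 0] norm_ge_zero[of "d 0"] norm_ge_zero[of "x 0"]
    by (smt (verit) mult_neg_pos)
  have min: "y \<in> minimizers F \<longleftrightarrow> (\<forall>w. F y \<le> F w)" for y
    by (auto simp: minimizers_def is_arg_min_def not_less)
  have main: "convergent (\<lambda>n. (norm (x n - y))\<^sup>2)" "summable (\<lambda>n. 2 * \<gamma> n * (F (x n) - F y))"
    if y: "y \<in> minimizers F" for y
  proof -
    \<comment> \<open>\<open>K\<close> recentres the growth bound at \<open>y\<close>: it comes from
      \<open>norm (x n) \<le> norm y + norm (x n - y)\<close> and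
      \<open>(p + q)\<^sup>2 \<le> 2 * p\<^sup>2 + 2 * q\<^sup>2\<close>, and its two summands bound
      the constant and the quadratic term.\<close>
    define K where "K = 2 * (M * (1 + norm y))\<^sup>2 + 2 * M\<^sup>2"
    have K: "(norm (d n))\<^sup>2 \<le> K * (1 + (norm (x n - y))\<^sup>2)" for n
    proof -
      let ?r = "norm (x n - y)"
      have "norm (x n) \<le> norm y + ?r"
        by (metis add.commute diff_add_cancel norm_triangle_ineq)
      then have "norm (d n) \<le> M * (1 + norm y) + M * ?r"
        using order_trans[OF bound mult_left_mono[OF _ M]]
        by (metis add_left_mono distrib_left group_cancel.add1)
      then have "(norm (d n))\<^sup>2 \<le> (M * (1 + norm y) + M * ?r)\<^sup>2"
        by (intro power_mono) auto
      also have "\<dots> \<le> 2 * (M * (1 + norm y))\<^sup>2 + 2 * (M * ?r)\<^sup>2"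
        using sum_squares_bound[of "M * (1 + norm y)" "M * ?r"] by (simp add: power2_sum)
      also have "\<dots> \<le> K * (1 + ?r\<^sup>2)"
        by (simp add: K_def distrib_left distrib_right power_mult_distrib)
      finally show ?thesis .
    qed
    have K0: "K \<ge> 0"
      by (simp add: K_def)
    have step: "(norm (x (Suc n) - y))\<^sup>2 \<le> (1 + K * (\<gamma> n)\<^sup>2) * (norm (x n - y))\<^sup>2 + K * (\<gamma> n)\<^sup>2
        - 2 * \<gamma> n * (F (x n) - F y)" for n
    proof -
      have "(norm (x (Suc n) - y))\<^sup>2 =
          (norm (x n - y))\<^sup>2 + 2 * \<gamma> n * (d n \<bullet> (y - x n)) + (\<gamma> n)\<^sup>2 * (norm (d n))\<^sup>2"
        unfolding update power2_norm_eq_inner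
        by (simp add: inner_diff_left inner_diff_right inner_commute algebra_simps)
          (simp add: power2_eq_square)
      moreover have "2 * \<gamma> n * (d n \<bullet> (y - x n)) \<le> 2 * \<gamma> n * (F y - F (x n))"
        using sub[of n y] step_pos[of n] by (intro mult_left_mono) auto
      moreover have "(\<gamma> n)\<^sup>2 * (norm (d n))\<^sup>2 \<le> (\<gamma> n)\<^sup>2 * (K * (1 + (norm (x n - y))\<^sup>2))"
        using K by (intro mult_left_mono) auto
      ultimately show ?thesis
        by (simp add: algebra_simps)
    qed
    have "2 * \<gamma> n * (F (x n) - F y) \<ge> 0" for n
      using y step_pos[of n] by (simp add: min)
    then show "convergent (\<lambda>n. (norm (x n - y))\<^sup>2)" "summable (\<lambda>n. 2 * \<gamma> n * (F (x n) - F y))"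
      using robbins_siegmund[where a = "\<lambda>n. (norm (x n - y))\<^sup>2" and b = "\<lambda>n. K * (\<gamma> n)\<^sup>2"
          and u = "\<lambda>n. 2 * \<gamma> n * (F (x n) - F y)", OF step] K0 summable_mult[OF step_square, of K]
      by simp_all
  qed
  obtain y where y: "y \<in> minimizers F"
    using ne by blast
  \<comment> \<open>Otherwise the gap stays at least \<open>1 / real (Suc k)\<close> from
    \<open>k\<close> on, and the summable weighted gaps dominate a multiple of
    \<open>\<gamma>\<close>, contradicting divergence of its sum.\<close>
  have "\<exists>n\<ge>k. F (x n) - F y < 1 / real (Suc k)" for k
  proof (rule ccontr)
    assume "\<not> ?thesis"
    then have ge: "F (x n) - F y \<ge> 1 / real (Suc k)" if "n \<ge> k" for n
      using that by force
    have "norm (\<gamma> n) \<le> real (Suc k) * (2 * \<gamma> n * (F (x n) - F y))" if "n \<ge> k" for n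
    proof -
      have "1 \<le> real (Suc k) * (F (x n) - F y)"
        using ge[OF that] by (simp add: field_simps)
      then have "2 * \<gamma> n * 1 \<le> 2 * \<gamma> n * (real (Suc k) * (F (x n) - F y))"
        using step_pos[of n] by (intro mult_left_mono) auto
      then show ?thesis
        using step_pos[of n] by (simp add: mult_ac)
    qed
    then have "summable \<gamma>"
      by (rule summable_comparison_test'[OF summable_mult[OF main(2)[OF y]]])
    then have "(\<lambda>n. \<Sum>k<n. \<gamma> k) \<longlonglongrightarrow> suminf \<gamma>"
      by (rule summable_LIMSEQ)
    then show False
      using step_sum not_tendsto_and_filterlim_at_infinity[OF sequentially_bot]
        filterlim_at_top_imp_at_infinity by blast
  qed
  then obtain r where r: "\<And>k. r k \<ge> k" "\<And>k. F (x (r k)) - F y < 1 / real (Suc k)"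
    by metis
  have "Bseq (\<lambda>n. (norm (x n - y))\<^sup>2)"
    using main(1)[OF y] by (rule convergent_imp_Bseq)
  then obtain R where R: "\<And>n. (norm (x n - y))\<^sup>2 \<le> R"
    by (auto simp: Bseq_def)
  have "x n \<in> cball y (sqrt R)" for n
    using real_le_rsqrt[OF R[of n]] by (simp add: dist_norm norm_minus_commute)
  then obtain z s where s: "strict_mono s" and xs: "((x \<circ> r) \<circ> s) \<longlonglongrightarrow> z"
    using compact_cball[of y "sqrt R"] unfolding compact_def by (metis comp_apply)
  \<comment> \<open>The indices \<open>r\<close> need not be monotone; \<open>r k \<ge> k\<close>
    already makes \<open>r (s k)\<close> tend to infinity.\<close>
  have rs: "filterlim (\<lambda>k. r (s k)) at_top sequentially"
  proof (rule filterlim_at_top_mono[OF filterlim_ident])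
    show "eventually (\<lambda>k. k \<le> r (s k)) sequentially"
      using r(1) seq_suble[OF s] le_trans by (blast intro: always_eventually)
  qed
  have Fz: "(\<lambda>k. F (x (r (s k)))) \<longlonglongrightarrow> F z"
    using continuous_on_tendsto_compose[OF cont xs] by simp
  have "(\<lambda>k. F y + 1 / real (Suc (s k))) \<longlonglongrightarrow> F y + 0"
    using LIMSEQ_subseq_LIMSEQ[OF LIMSEQ_inverse_real_of_nat s]
    by (intro tendsto_intros) (simp add: comp_def inverse_eq_divide)
  then have "F z \<le> F y"
    using LIMSEQ_le[OF Fz, of _ "F y"] r(2)[of "s _"] by (force simp: algebra_simps less_imp_le)
  then have z: "z \<in> minimizers F"
    using y unfolding min by (meson order_trans)
  \<comment> \<open>The distance argument is now applied to the cluster point \<open>z\<close>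
    itself: the limit exists along the whole sequence, and the subsequence identifies it as
    0.\<close>
  obtain L where L: "(\<lambda>n. (norm (x n - z))\<^sup>2) \<longlonglongrightarrow> L"
    using main(1)[OF z] convergent_def by blast
  have "(\<lambda>k. (norm (x (r (s k)) - z))\<^sup>2) \<longlonglongrightarrow> (norm (z - z))\<^sup>2"
    using xs by (intro tendsto_intros) (simp add: comp_def)
  then have "L = 0"
    using LIMSEQ_unique[OF filterlim_compose[OF L rs]] by simp
  then have "(\<lambda>n. sqrt ((norm (x n - z))\<^sup>2)) \<longlonglongrightarrow> sqrt 0"
    using L by (intro tendsto_intros) simp
  then have "x \<longlonglongrightarrow> z"
    by (simp add: tendsto_norm_zero_iff LIM_zero_iff)
  then show ?thesis
    using that z by blast
qed

section \<open>The network update as a subgradient method, and conservation of the average\<close>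

theorem theorem2:
  fixes E :: "'v::finite set set"
    and lam C :: real
    and f :: "'v \<Rightarrow> real \<Rightarrow> real"
    and \<gamma> :: "nat \<Rightarrow> real"
    and x :: "nat \<Rightarrow> real ^ 'v"
    and g :: "nat \<Rightarrow> 'v \<Rightarrow> real"
  assumes graph: "connected_graph E"
    and lam_pos: "lam > 0"
    and convex: "\<And>v. convex_on UNIV (f v)"
    and attained: "minimizers (\<lambda>t. \<Sum>v\<in>UNIV. f v t) \<noteq> {}"
    and C_pos: "C > 0"
    and growth: "\<And>v t h. h \<in> subdifferential (f v) t \<Longrightarrow> \<bar>h\<bar> \<le> C * (1 + \<bar>t\<bar>)"
    and step_pos: "\<And>n. \<gamma> n > 0"
    and step_sum: "filterlim (\<lambda>n. \<Sum>k<n. \<gamma> k) at_top sequentially"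
    and step_square: "summable (\<lambda>n. (\<gamma> n)\<^sup>2)"
    and subgradient: "\<And>n v. - g n v \<in> subdifferential (f v) (x n $ v)"
    and update: "\<And>n v. x (Suc n) $ v = x n $ v +
          \<gamma> n * (g n v + lam * (\<Sum>w | {v, w} \<in> E. sgn (x n $ w - x n $ v)))"
  shows "(minimizers (tv_objective E lam f) \<noteq> {} \<longrightarrow>
            (\<lambda>n. infdist (x n) (minimizers (tv_objective E lam f))) \<longlonglongrightarrow> 0)
       \<and> ((\<forall>v t. f v t = 1/2 * (t - x 0 $ v)\<^sup>2) \<longrightarrow>
            (\<forall>n v. g n v = x 0 $ v - x n $ v) \<and> (\<forall>n. average (x n) = average (x 0)))"
proof (intro conjI impI allI)
  have E2: "\<forall>e\<in>E. card e = 2"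
    using graph by (simp add: connected_graph_def)
  define S where "S n v = (\<Sum>w | {v, w} \<in> E. sgn (x n $ w - x n $ v))" for n v
  have upd: "x (Suc n) $ v = x n $ v + \<gamma> n * (g n v + lam * S n v)" for n v
    using update by (simp add: S_def)
  {
    assume ne: "minimizers (tv_objective E lam f) \<noteq> {}"
    \<comment> \<open>The negated update direction is a subgradient of the objective at
      \<open>x n\<close>: \<open>- g n v\<close> comes from \<open>f v\<close>, and
      \<open>- lam * S n v\<close> from the total variation.\<close>
    define d :: "nat \<Rightarrow> real ^ 'v" where "d n = (\<chi> v. - (g n v + lam * S n v))" for n
    have sub: "tv_objective E lam f y \<ge> tv_objective E lam f (x n) + d n \<bullet> (y - x n)" for n y
    proof -
      have "(\<Sum>v\<in>UNIV. f v (x n $ v) + - g n v * (y $ v - x n $ v)) \<le> (\<Sum>v\<in>UNIV. f v (y $ v))"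
        using subgradient by (intro sum_mono) (simp add: subdifferential_def)
      moreover have "lam * tv_norm E y \<ge>
          lam * (tv_norm E (x n) - (\<Sum>v\<in>UNIV. S n v * (y $ v - x n $ v)))"
        using tv_norm_subgradient[OF E2, of "x n" y] lam_pos
        by (intro mult_left_mono) (auto simp: S_def)
      moreover have "d n \<bullet> (y - x n) = (\<Sum>v\<in>UNIV. - g n v * (y $ v - x n $ v))
          - lam * (\<Sum>v\<in>UNIV. S n v * (y $ v - x n $ v))"
        by (simp add: d_def inner_vec_def sum_distrib_left sum_subtractf[symmetric] algebra_simps)
      ultimately show ?thesis
        by (simp add: tv_objective_def sum.distrib right_diff_distrib)
    qed
    have S: "\<bar>S n v\<bar> \<le> real CARD('v)" for n v
    proof -
      have "\<bar>S n v\<bar> \<le> (\<Sum>w | {v, w} \<in> E. \<bar>sgn (x n $ w - x n $ v)\<bar>)"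
        unfolding S_def by (rule sum_abs)
      also have "\<dots> \<le> (\<Sum>w | {v, w} \<in> E. 1)"
        by (intro sum_mono) (simp add: sgn_if)
      also have "\<dots> \<le> real CARD('v)"
        by (simp add: card_mono)
      finally show ?thesis .
    qed
    \<comment> \<open>The sign part is bounded by a constant, which is absorbed into the linear
      growth because \<open>1 \<le> 1 + norm (x n)\<close>.\<close>
    have d_component: "\<bar>d n $ v\<bar> \<le> (C + lam * real CARD('v)) * (1 + norm (x n))" for n v
    proof -
      have "\<bar>g n v\<bar> \<le> C * (1 + \<bar>x n $ v\<bar>)"
        using growth[OF subgradient] by simp
      also have "\<dots> \<le> C * (1 + norm (x n))"
        using C_pos component_le_norm_cart[of "x n" v] by simp
      finally have "\<bar>g n v\<bar> \<le> C * (1 + norm (x n))" .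
      moreover have "\<bar>lam * S n v\<bar> \<le> lam * real CARD('v)"
        using S lam_pos by (simp add: abs_mult)
      moreover have "lam * real CARD('v) * 1 \<le> lam * real CARD('v) * (1 + norm (x n))"
        using lam_pos by (intro mult_left_mono) auto
      ultimately show ?thesis
        by (simp add: d_def distrib_right)
    qed
    \<comment> \<open>The extra factor \<open>real CARD('v)\<close> is the cost of estimating the
      Euclidean norm by the sum of the absolute components.\<close>
    have bound: "norm (d n) \<le> real CARD('v) * (C + lam * real CARD('v)) * (1 + norm (x n))" for n
    proof -
      have "norm (d n) \<le> (\<Sum>v\<in>UNIV. \<bar>d n $ v\<bar>)"
        by (rule norm_le_l1_cart)
      also have "\<dots> \<le> real CARD('v) * ((C + lam * real CARD('v)) * (1 + norm (x n)))"
        using sum_bounded_above[of UNIV "\<lambda>v. \<bar>d n $ v\<bar>"] d_component by simp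
      finally show ?thesis
        by (simp add: mult.assoc)
    qed
    have step: "x (Suc n) = x n - \<gamma> n *\<^sub>R d n" for n
      by (simp add: vec_eq_iff upd d_def algebra_simps)
    obtain z where z: "z \<in> minimizers (tv_objective E lam f)" "x \<longlonglongrightarrow> z"
      by (rule subgradient_method_convergence[OF continuous_on_tv_objective[OF E2 convex] ne
            step_pos step_sum step_square sub bound step])
    show "(\<lambda>n. infdist (x n) (minimizers (tv_objective E lam f))) \<longlonglongrightarrow> 0"
    proof (rule Lim_null_comparison)
      show "\<forall>\<^sub>F n in sequentially.
          norm (infdist (x n) (minimizers (tv_objective E lam f))) \<le> dist (x n) z"
        using z(1) by (simp add: infdist_le infdist_nonneg)
      show "(\<lambda>n. dist (x n) z) \<longlonglongrightarrow> 0"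
        using z(2) tendsto_dist_iff by blast
    qed
  }
  {
    assume quadratic: "\<forall>v t. f v t = 1/2 * (t - x 0 $ v)\<^sup>2"
    show g: "g n v = x 0 $ v - x n $ v" for n v
    proof -
      have "f v = (\<lambda>t. 1/2 * (t - x 0 $ v)\<^sup>2)"
        using quadratic by auto
      then show ?thesis
        using subdifferential_quadratic[of "- g n v"] subgradient[of n v] by fastforce
    qed
    have "(\<Sum>v\<in>UNIV. x n $ v) = (\<Sum>v\<in>UNIV. x 0 $ v)" for n
    proof (induction n)
      case (Suc n)
      \<comment> \<open>The bracket vanishes: the first two sums cancel by the induction hypothesis,
        and the sign terms cancel in pairs.\<close>
      have "(\<Sum>v\<in>UNIV. x (Suc n) $ v) = (\<Sum>v\<in>UNIV. x n $ v)
          + \<gamma> n * ((\<Sum>v\<in>UNIV. x 0 $ v) - (\<Sum>v\<in>UNIV. x n $ v) + lam * (\<Sum>v\<in>UNIV. S n v))"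
        by (simp add: upd g sum.distrib sum_subtractf sum_distrib_left[symmetric])
      then show ?case
        using Suc sum_neighbours_sgn[where E = E and x = "x n"] by (simp add: S_def)
    qed simp
    then show "average (x n) = average (x 0)" for n
      by (simp add: average_def)
  }
qed

end
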